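(* Let $n\ge2$, let $\Sigma\subset\mathbb R^n$ be an embedded $C^2$ hypersurface, let $g_1,\ldots,g_n>0$ be pair-sum nonresonant weights, let $D_t=\operatorname{diag}(t^{g_1},\ldots,t^{g_n})$ for $t>0$, and put $N=\binom n2$. If $D_{t_1}\Sigma,\ldots,D_{t_N}\Sigma$ are minimal for $N$ distinct positive numbers $t_1,\ldots,t_N$, then for every regular defining function $F:U\to\mathbb R$ of $\Sigma$ and all $1\le i<j\le n$ one has $C_{ij}[F]=0$ on $\Sigma\cap U$.
   Context: Weights $g_1,\ldots,g_n>0$ are pair-sum nonresonant if the $\binom n2$ sums $g_i+g_j$ ($1\le i<j\le n$) are all distinct. A $C^2$ hypersurface is minimal if its Euclidean mean-curvature vector vanishes identically. A regular defining function of $\Sigma$ near a point of $\Sigma$ is a $C^2$ function $F$ on an open neighborhood $U\subset\mathbb R^n$ of that point with $\Sigma\cap U=\{x\in U:F(x)=0\}$ and $\nabla F\ne0$ on $\Sigma\cap U$. With subscripts on $F$ denoting partial derivatives, for $i<j$, $$C_{ij}[F]=F_j^2F_{ii}+F_i^2F_{jj}-2F_iF_jF_{ij}.$$ *)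

theory Defs
  imports "HOL-Analysis.Analysis"
begin

text \<open>
  Points of $n$-dimensional Euclidean space have type \<open>real^'n\<close>, with \<open>'n\<close> a finite linearly
  ordered index type playing the role of $1 < \dots < n$.  A function on an open set \<open>U\<close> is
  represented by a total function; everything below depends only on its values on \<open>U\<close>.
\<close>

definition partial :: "'n \<Rightarrow> (real^'n \<Rightarrow> real) \<Rightarrow> real^'n \<Rightarrow> real" where
  "partial i F x = frechet_derivative F (at x) (axis i 1)"

definition grad :: "(real^'n \<Rightarrow> real) \<Rightarrow> real^'n \<Rightarrow> real^'n" where
  "grad F x = (\<chi> i. partial i F x)"

definition C2_on :: "(real^'n \<Rightarrow> real) \<Rightarrow> (real^'n) set \<Rightarrow> bool" where
  "C2_on F U \<longleftrightarrow> F differentiable_on U \<and>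
     (\<forall>i. partial i F differentiable_on U) \<and>
     (\<forall>i j. continuous_on U (partial j (partial i F)))"

definition regular_defining_function ::
  "(real^'n) set \<Rightarrow> (real^'n) set \<Rightarrow> (real^'n \<Rightarrow> real) \<Rightarrow> bool" where
  "regular_defining_function S U F \<longleftrightarrow>
     open U \<and> C2_on F U \<and> S \<inter> U = {x \<in> U. F x = 0} \<and> (\<forall>x \<in> S \<inter> U. grad F x \<noteq> 0)"

definition C2_hypersurface :: "(real^'n) set \<Rightarrow> bool" where
  "C2_hypersurface S \<longleftrightarrow> (\<forall>p \<in> S. \<exists>U F. p \<in> U \<and> regular_defining_function S U F)"

text \<open>Tangent vectors are the velocities of curves in the hypersurface.\<close>

definition tangent_space :: "(real^'n) set \<Rightarrow> real^'n \<Rightarrow> (real^'n) set" where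
  "tangent_space S p = {v. \<exists>\<gamma> :: real \<Rightarrow> real^'n.
     \<gamma> 0 = p \<and> (\<forall>\<^sub>F s in at 0. \<gamma> s \<in> S) \<and> (\<gamma> has_vector_derivative v) (at 0)}"

definition unit_normal_field ::
  "(real^'n) set \<Rightarrow> (real^'n) set \<Rightarrow> (real^'n \<Rightarrow> real^'n) \<Rightarrow> bool" where
  "unit_normal_field S U \<nu> \<longleftrightarrow> continuous_on (S \<inter> U) \<nu> \<and>
     (\<forall>q \<in> S \<inter> U. norm (\<nu> q) = 1 \<and> (\<forall>v \<in> tangent_space S q. \<nu> q \<bullet> v = 0))"

definition orthonormal_basis_of :: "(real^'n) set \<Rightarrow> (real^'n) set \<Rightarrow> bool" where
  "orthonormal_basis_of T B \<longleftrightarrow>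
     B \<subseteq> T \<and> pairwise orthogonal B \<and> (\<forall>e \<in> B. norm e = 1) \<and> span B = T"

text \<open>
  The mean-curvature vector is the trace over the tangent space of the vector-valued second
  fundamental form \<open>(v, w) \<mapsto> - (D\<^sub>v \<nu> \<bullet> w) \<nu>\<close>, for a local unit normal \<open>\<nu>\<close>.  It does not change
  when \<open>\<nu>\<close> is replaced by \<open>- \<nu>\<close>.  The derivative \<open>L\<close> of \<open>\<nu>\<close> is taken within \<open>S\<close>; as a linear map
  on the whole space it is not unique, but its restriction to the tangent space is.  The trace
  is not divided by $n - 1$.
\<close>

definition has_mean_curvature_vector ::
  "(real^'n) set \<Rightarrow> real^'n \<Rightarrow> real^'n \<Rightarrow> bool" where
  "has_mean_curvature_vector S p H \<longleftrightarrow> (\<exists>U \<nu> L B.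
     open U \<and> p \<in> U \<and> unit_normal_field S U \<nu> \<and> (\<nu> has_derivative L) (at p within S) \<and>
     orthonormal_basis_of (tangent_space S p) B \<and>
     H = (\<Sum>e\<in>B. - (L e \<bullet> e) *\<^sub>R \<nu> p))"

definition minimal :: "(real^'n) set \<Rightarrow> bool" where
  "minimal S \<longleftrightarrow> (\<forall>p \<in> S. has_mean_curvature_vector S p 0)"

definition pair_sum_nonresonant :: "('n::linorder \<Rightarrow> real) \<Rightarrow> bool" where
  "pair_sum_nonresonant g \<longleftrightarrow> inj_on (\<lambda>(i, j). g i + g j) {(i, j). i < j}"

definition weighted_dilation :: "('n \<Rightarrow> real) \<Rightarrow> real \<Rightarrow> real^'n \<Rightarrow> real^'n" where
  "weighted_dilation g t x = (\<chi> i. t powr g i * x $ i)"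

text \<open>\<open>partial j (partial i F)\<close> is the second partial derivative $F_{ij}$.\<close>

definition C_form :: "'n \<Rightarrow> 'n \<Rightarrow> (real^'n \<Rightarrow> real) \<Rightarrow> real^'n \<Rightarrow> real" where
  "C_form i j F x =
     (partial j F x)\<^sup>2 * partial i (partial i F) x
     + (partial i F x)\<^sup>2 * partial j (partial j F) x
     - 2 * partial i F x * partial j F x * partial j (partial i F) x"

end

theory Submission
  imports Defs
begin

text \<open>
  On a level set \<open>{F = 0}\<close> with \<open>G = \<nabla>F\<close> and Hessian \<open>A\<close>, vanishing mean curvature means
  \<open>\<bar>G\<bar>\<^sup>2 tr A = A G \<bullet> G\<close>, that is \<open>\<Sum>i<j. C\<^sub>i\<^sub>j[F] = 0\<close>.  Replacing \<open>F\<close> by the defining function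
  \<open>F \<circ> D\<^sub>s\<inverse>\<close> of the dilated hypersurface multiplies \<open>C\<^sub>i\<^sub>j\<close> by \<open>s powr (-2 (g i + g j))\<close>.  So, at each
  point, the exponential sum \<open>z \<mapsto> \<Sum>i<j. C\<^sub>i\<^sub>j[F] * exp (-2 (g i + g j) z)\<close> with \<open>N\<close> distinct
  exponents has the \<open>N\<close> distinct zeros \<open>ln (t k)\<close>, and by Rolle's theorem its coefficients vanish.

  Since only the velocity at 0 of a curve enters the definition of a tangent vector, the curves
  needed to realise every vector orthogonal to \<open>G\<close> may be discontinuous away from 0.  The
  intermediate value theorem thus suffices in place of the implicit function theorem.
\<close>

subsection \<open>Zeros of exponential sums\<close>

text \<open>Rolle's theorem between consecutive zeros: passing to the derivative costs at most one
  zero.\<close>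

lemma card_zeros_deriv_ge:
  fixes f f' :: "real \<Rightarrow> real"
  assumes "finite Z" "Z \<noteq> {}"
    and f: "\<And>x. (f has_real_derivative f' x) (at x)"
    and Z: "\<And>z. z \<in> Z \<Longrightarrow> f z = 0"
  obtains Y where "finite Y" "Suc (card Y) = card Z" "\<And>y. y \<in> Y \<Longrightarrow> f' y = 0"
proof -
  \<comment> \<open>The clause \<open>\<exists>z\<in>Z. y < z\<close> strengthens the induction:
    zeros enter in increasing order, so the old points of \<open>Y\<close> lie below
    \<open>Max A\<close> and differ from the new one, which lies between \<open>Max A\<close> and
    \<open>b\<close>.\<close>
  have "Z \<noteq> {} \<longrightarrow> (\<forall>z\<in>Z. f z = 0) \<longrightarrow>
     (\<exists>Y. finite Y \<and> Suc (card Y) = card Z \<and> (\<forall>y\<in>Y. f' y = 0 \<and> (\<exists>z\<in>Z. y < z)))"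
    using \<open>finite Z\<close>
  proof (induction rule: finite_linorder_max_induct)
    case (insert b A)
    show ?case
    proof (cases "A = {}")
      case True
      then show ?thesis by (intro impI exI[of _ "{}"]) auto
    next
      case False
      show ?thesis
      proof (intro impI)
        assume zero: "\<forall>z\<in>insert b A. f z = 0"
        then obtain Y where Y: "finite Y" "Suc (card Y) = card A"
          "\<And>y. y \<in> Y \<Longrightarrow> f' y = 0" "\<And>y. y \<in> Y \<Longrightarrow> \<exists>z\<in>A. y < z"
          using insert.IH False by auto
        define a where "a = Max A"
        have a: "a \<in> A" "\<And>z. z \<in> A \<Longrightarrow> z \<le> a"
          using False insert.hyps by (auto simp: a_def)
        have "a < b" using a insert.hyps by auto
        then obtain y where y: "a < y" "y < b" "f b - f a = (b - a) * f' y"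
          using MVT2[of a b f f'] f by blast
        then have "f' y = 0" using zero a by auto
        moreover have "y \<notin> Y" using Y(4) a(2) y(1) by force
        ultimately show "\<exists>Y. finite Y \<and> Suc (card Y) = card (insert b A) \<and>
            (\<forall>y\<in>Y. f' y = 0 \<and> (\<exists>z\<in>insert b A. y < z))"
          using Y y(2) insert.hyps by (intro exI[of _ "insert y Y"]) auto
      qed
    qed
  qed simp
  then show thesis using that assms by blast
qed

text \<open>Induction on the number of terms. Division by \<open>exp (l k * z)\<close> makes the
  term of \<open>k\<close> constant and differentiation removes it; Rolle's theorem loses one zero
  while the sum loses one term. The factors \<open>l i - l k\<close> that appear are nonzero since
  the exponents are distinct.\<close>

lemma exp_sum_zero_imp_coeffs_zero:
  fixes c l :: "'a \<Rightarrow> real"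
  assumes "finite I" "inj_on l I" "finite Z" "card I \<le> card Z"
    and "\<And>z. z \<in> Z \<Longrightarrow> (\<Sum>i\<in>I. c i * exp (l i * z)) = 0"
  shows "\<forall>i\<in>I. c i = 0"
  using assms
proof (induction I arbitrary: c l Z rule: finite_induct)
  case (insert k I)
  have "Z \<noteq> {}" using insert by auto
  define f where "f z = c k + (\<Sum>i\<in>I. c i * exp ((l i - l k) * z))" for z
  define f' where "f' z = (\<Sum>i\<in>I. c i * (l i - l k) * exp ((l i - l k) * z))" for z
  have "(f has_real_derivative f' x) (at x)" for x
    unfolding f_def f'_def by (auto intro!: derivative_eq_intros sum.cong)
  moreover have f0: "f z = 0" if "z \<in> Z" for z
  proof -
    have "f z = (\<Sum>i\<in>insert k I. c i * exp (l i * z)) * exp (- (l k * z))"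
      using insert.hyps
      by (simp add: f_def sum_distrib_right distrib_right mult.assoc left_diff_distrib
          flip: exp_add)
    then show ?thesis using insert.prems(4) that by simp
  qed
  ultimately obtain Y where Y: "finite Y" "Suc (card Y) = card Z" "\<And>y. y \<in> Y \<Longrightarrow> f' y = 0"
    using card_zeros_deriv_ge[OF \<open>finite Z\<close> \<open>Z \<noteq> {}\<close>, of f f'] by metis
  have "inj_on (\<lambda>i. l i - l k) I"
    using insert.prems(1) by (auto simp: inj_on_def)
  moreover have "card I \<le> card Y" using Y insert by auto
  ultimately have "\<forall>i\<in>I. c i * (l i - l k) = 0"
    using insert.IH[of "\<lambda>i. l i - l k" Y "\<lambda>i. c i * (l i - l k)"] Y by (simp add: f'_def)
  moreover have "l i \<noteq> l k" if "i \<in> I" for i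
    using insert.prems(1) insert.hyps that by (auto simp: inj_on_def)
  ultimately have I: "\<forall>i\<in>I. c i = 0" by auto
  \<comment> \<open>With the other coefficients gone, \<open>f\<close> is the constant
    \<open>c k\<close>, so a single zero settles it.\<close>
  obtain z where "z \<in> Z" using \<open>Z \<noteq> {}\<close> by auto
  then have "c k = 0" using f0[of z] I by (simp add: f_def)
  then show ?case using I by auto
qed simp

subsection \<open>Symmetry of second derivatives\<close>

text \<open>The second difference is the increment over \<open>{0..s}\<close> of a first difference
  in direction \<open>w\<close>, so the mean value theorem makes it \<open>s\<close> times a
  difference of two values of the derivative in direction \<open>v\<close>. Differentiability of
  that derivative at \<open>p\<close> estimates both values.\<close>

lemma second_difference_approx:
  fixes f :: "'a::real_normed_vector \<Rightarrow> real"
  assumes "open U" "p \<in> U"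
    and f: "\<And>x. x \<in> U \<Longrightarrow> (f has_derivative f' x) (at x)"
    and f'': "((\<lambda>x. f' x v) has_derivative f'') (at p)"
    and "e > 0"
  shows "\<forall>\<^sub>F s in at_right 0.
    \<bar>f (p + s *\<^sub>R v + s *\<^sub>R w) - f (p + s *\<^sub>R v) - f (p + s *\<^sub>R w) + f p - s\<^sup>2 * f'' w\<bar> \<le> e * s\<^sup>2"
proof -
  interpret L: bounded_linear f'' using f'' by (rule has_derivative_bounded_linear)
  \<comment> \<open>For \<open>0 \<le> r \<le> s\<close> the displacements
    \<open>r *\<^sub>R v\<close> and \<open>r *\<^sub>R v + s *\<^sub>R w\<close> have norm at most
    \<open>s * K\<close>; the summand 1 keeps \<open>K\<close> positive when
    \<open>v = w = 0\<close>.\<close>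
  define K where "K = norm v + norm w + 1"
  have K: "K > 0" "norm v \<le> K" "norm v + norm w \<le> K"
    by (auto simp: K_def add_nonneg_pos)
  obtain d1 where d1: "d1 > 0" "ball p d1 \<subseteq> U"
    using assms(1,2) openE by blast
  \<comment> \<open>Two approximations follow, each with error at most
    \<open>e / (2 * K) * (s * K) = e * s / 2\<close>.\<close>
  obtain d2 where d2: "d2 > 0"
    "\<And>y. norm (y - p) < d2 \<Longrightarrow> norm (f' y v - f' p v - f'' (y - p)) \<le> e / (2 * K) * norm (y - p)"
    using f''[unfolded has_derivative_at_alt] \<open>e > 0\<close> K(1)
    by (metis divide_pos_pos mult_pos_pos zero_less_numeral)
  define d where "d = min d1 d2"
  have "\<bar>f (p + s *\<^sub>R v + s *\<^sub>R w) - f (p + s *\<^sub>R v) - f (p + s *\<^sub>R w) + f p - s\<^sup>2 * f'' w\<bar> \<le> e * s\<^sup>2"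
    if s: "0 < s" "s < d / K" for s
  proof -
    have sK: "s * K < d" using s K by (simp add: field_simps)
    have n1: "norm (r *\<^sub>R v) \<le> s * K" if "0 \<le> r" "r \<le> s" for r
      using that K(1,2) by (auto intro!: mult_mono)
    have n2: "norm (r *\<^sub>R v + s *\<^sub>R w) \<le> s * K" if "0 \<le> r" "r \<le> s" for r
    proof -
      have "norm (r *\<^sub>R v + s *\<^sub>R w) \<le> r * norm v + s * norm w"
        using norm_triangle_ineq[of "r *\<^sub>R v" "s *\<^sub>R w"] that s by simp
      also have "\<dots> \<le> s * norm v + s * norm w"
        using that by (simp add: mult_right_mono)
      also have "\<dots> \<le> s * K" using K(3) s(1) by (simp flip: distrib_left)
      finally show ?thesis .
    qed
    have inU: "p + h \<in> U" if "norm h \<le> s * K" for h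
      using that sK d1(2) by (auto simp: d_def dist_norm subset_iff)
    define \<phi> where "\<phi> r = f (p + (r *\<^sub>R v + s *\<^sub>R w)) - f (p + r *\<^sub>R v)" for r
    have der: "(\<phi> has_real_derivative f' (p + (r *\<^sub>R v + s *\<^sub>R w)) v - f' (p + r *\<^sub>R v) v) (at r)"
      if "0 \<le> r" "r \<le> s" for r
    proof -
      note f1 = f[OF inU[OF n1[OF that]]] and f2 = f[OF inU[OF n2[OF that]]]
      interpret l1: bounded_linear "f' (p + r *\<^sub>R v)" using f1 by (rule has_derivative_bounded_linear)
      interpret l2: bounded_linear "f' (p + (r *\<^sub>R v + s *\<^sub>R w))"
        using f2 by (rule has_derivative_bounded_linear)
      have a1: "((\<lambda>r. p + r *\<^sub>R v) has_derivative (\<lambda>h. h *\<^sub>R v)) (at r)"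
        by (auto intro!: derivative_eq_intros)
      have a2: "((\<lambda>r. p + (r *\<^sub>R v + s *\<^sub>R w)) has_derivative (\<lambda>h. h *\<^sub>R v)) (at r)"
        by (auto intro!: derivative_eq_intros)
      show ?thesis
        unfolding \<phi>_def has_field_derivative_def
        by (rule has_derivative_eq_rhs[OF has_derivative_diff[OF
               has_derivative_compose[OF a2 f2] has_derivative_compose[OF a1 f1]]])
           (simp add: fun_eq_iff l1.scaleR l2.scaleR algebra_simps)
    qed
    obtain r where r: "0 < r" "r < s"
      and mvt: "\<phi> s - \<phi> 0 = (s - 0) * (f' (p + (r *\<^sub>R v + s *\<^sub>R w)) v - f' (p + r *\<^sub>R v) v)"
      using MVT2[OF s(1), of \<phi> "\<lambda>r. f' (p + (r *\<^sub>R v + s *\<^sub>R w)) v - f' (p + r *\<^sub>R v) v"]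
        der by metis
    define x y where "x = f' (p + (r *\<^sub>R v + s *\<^sub>R w)) v" and "y = f' (p + r *\<^sub>R v) v"
    have "\<bar>x - f' p v - f'' (r *\<^sub>R v + s *\<^sub>R w)\<bar> \<le> e / (2 * K) * norm (r *\<^sub>R v + s *\<^sub>R w)"
      using d2(2)[of "p + (r *\<^sub>R v + s *\<^sub>R w)"] n2[of r] r sK by (auto simp: x_def d_def)
    also have "\<dots> \<le> e / (2 * K) * (s * K)"
      using n2[of r] r K \<open>e > 0\<close> by (intro mult_left_mono) auto
    also have "\<dots> = e * s / 2" using K by simp
    finally have x: "\<bar>x - f' p v - f'' (r *\<^sub>R v + s *\<^sub>R w)\<bar> \<le> e * s / 2" .
    have "\<bar>y - f' p v - f'' (r *\<^sub>R v)\<bar> \<le> e / (2 * K) * norm (r *\<^sub>R v)"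
      using d2(2)[of "p + r *\<^sub>R v"] n1[of r] r sK by (auto simp: y_def d_def)
    also have "\<dots> \<le> e / (2 * K) * (s * K)"
      using n1[of r] r K \<open>e > 0\<close> by (intro mult_left_mono) auto
    also have "\<dots> = e * s / 2" using K by simp
    finally have y: "\<bar>y - f' p v - f'' (r *\<^sub>R v)\<bar> \<le> e * s / 2" .
    \<comment> \<open>The terms \<open>f' p v\<close> and \<open>r * f'' v\<close> cancel between
      the two approximations.\<close>
    have "\<bar>x - y - s * f'' w\<bar> \<le> e * s"
      using x y unfolding L.add L.scaleR real_scaleR_def by linarith
    then have "s * \<bar>x - y - s * f'' w\<bar> \<le> s * (e * s)"
      using s by (intro mult_left_mono) auto
    moreover have SQ: "0 < s \<Longrightarrow> s * \<bar>x - y - s * f'' w\<bar> = \<bar>s * (x - y) - s\<^sup>2 * f'' w\<bar>" for s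
      using abs_mult[of s "x - y - s * f'' w"] by (simp add: power2_eq_square algebra_simps)
    moreover have "s * \<bar>x - y - s * f'' w\<bar> = \<bar>s * (x - y) - s\<^sup>2 * f'' w\<bar>"
      by (rule SQ[OF s(1)])
    ultimately have "\<bar>\<phi> s - \<phi> 0 - s\<^sup>2 * f'' w\<bar> \<le> e * s\<^sup>2"
      using mvt by (simp add: x_def y_def power2_eq_square algebra_simps)
    then show ?thesis by (simp add: \<phi>_def algebra_simps)
  qed
  moreover have "d / K > 0" using d1 d2 K by (simp add: d_def)
  ultimately show ?thesis
    unfolding eventually_at_right_field by blast
qed

text \<open>The second difference is symmetric in \<open>v\<close> and \<open>w\<close>, so it
  approximates both \<open>s\<^sup>2 * Av w\<close> and \<open>s\<^sup>2 * Aw v\<close>.\<close>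

lemma symmetric_second_derivative:
  fixes f :: "'a::real_normed_vector \<Rightarrow> real"
  assumes "open U" "p \<in> U"
    and "\<And>x. x \<in> U \<Longrightarrow> (f has_derivative f' x) (at x)"
    and v: "((\<lambda>x. f' x v) has_derivative Av) (at p)"
    and w: "((\<lambda>x. f' x w) has_derivative Aw) (at p)"
  shows "Av w = Aw v"
proof (rule ccontr)
  assume ne: "Av w \<noteq> Aw v"
  \<comment> \<open>The two errors total at most \<open>2 * e * s\<^sup>2\<close>, whereas the gap
    to be bridged is \<open>3 * e * s\<^sup>2\<close>.\<close>
  define e where "e = \<bar>Av w - Aw v\<bar> / 3"
  have "e > 0" using ne by (simp add: e_def)
  define \<Delta> where "\<Delta> s = f (p + s *\<^sub>R v + s *\<^sub>R w) - f (p + s *\<^sub>R v) - f (p + s *\<^sub>R w) + f p" for s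
  have "\<forall>\<^sub>F s in at_right 0. \<bar>\<Delta> s - s\<^sup>2 * Av w\<bar> \<le> e * s\<^sup>2"
    unfolding \<Delta>_def using assms(1-3) v \<open>e > 0\<close>
    by (rule second_difference_approx[where f' = f'])
  moreover have "\<forall>\<^sub>F s in at_right 0. \<bar>\<Delta> s - s\<^sup>2 * Aw v\<bar> \<le> e * s\<^sup>2"
  proof -
    have "\<Delta> s = f (p + s *\<^sub>R w + s *\<^sub>R v) - f (p + s *\<^sub>R w) - f (p + s *\<^sub>R v) + f p" for s
      by (simp add: \<Delta>_def ac_simps)
    then show ?thesis
      using second_difference_approx[where f' = f' and v = w and w = v, of U p f] assms(1-3) w \<open>e > 0\<close>
      by simp
  qed
  ultimately have "\<forall>\<^sub>F s in at_right 0. \<bar>s\<^sup>2 * Av w - s\<^sup>2 * Aw v\<bar> \<le> 2 * e * s\<^sup>2"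
    by eventually_elim linarith
  moreover have "\<forall>\<^sub>F s::real in at_right 0. s > 0"
    by (simp add: eventually_at_right_less)
  ultimately have "\<forall>\<^sub>F s::real in at_right 0. False"
  proof eventually_elim
    case (elim s)
    have SQ2: "\<bar>s\<^sup>2 * Av w - s\<^sup>2 * Aw v\<bar> = s\<^sup>2 * \<bar>Av w - Aw v\<bar>"
      using abs_mult[of "s\<^sup>2" "Av w - Aw v"] by (simp add: right_diff_distrib)
    have "s\<^sup>2 * \<bar>Av w - Aw v\<bar> \<le> s\<^sup>2 * (2 * e)"
      using SQ2 elim by (simp add: ac_simps)
    then show False using elim ne by (simp add: e_def)
  qed
  then show False by simp
qed

subsection \<open>Mean curvature of level sets\<close>

text \<open>Basis independence of the trace, by expanding each \<open>axis i 1\<close> in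
  \<open>B\<close>. It allows a basis adapted to the tangent space to be traded for
  coordinates.\<close>

lemma sum_inner_orthonormal_basis:
  fixes A :: "real^'n \<Rightarrow> real^'n"
  assumes "linear A" "pairwise orthogonal B" "\<And>b. b \<in> B \<Longrightarrow> norm b = 1" "span B = UNIV"
  shows "(\<Sum>b\<in>B. A b \<bullet> b) = (\<Sum>i\<in>UNIV. A (axis i 1) $ i)"
proof -
  have fin: "finite B" using assms by (simp add: pairwise_orthogonal_imp_finite)
  have "A (axis i 1) = (\<Sum>b\<in>B. (b $ i) *\<^sub>R A b)" for i
  proof -
    have "axis i 1 = (\<Sum>b\<in>B. (b $ i) *\<^sub>R b)"
      using orthonormal_basis_expand[OF assms(2,3) _ fin, of "axis i 1"] assms(4)
      by (simp add: inner_axis')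
    then show ?thesis
      using assms(1) by (simp add: linear_sum linear_scale o_def)
  qed
  then have "(\<Sum>i\<in>UNIV. A (axis i 1) $ i) = (\<Sum>i\<in>UNIV. \<Sum>b\<in>B. b $ i * A b $ i)"
    by simp
  also have "\<dots> = (\<Sum>b\<in>B. A b \<bullet> b)"
    by (subst sum.swap) (simp add: inner_vec_def mult.commute)
  finally show ?thesis by simp
qed

text \<open>At \<open>q + s *\<^sub>R v + r *\<^sub>R n\<close> the linear part of \<open>F\<close>
  is \<open>r * (n \<bullet> n)\<close>, and the error is small compared with
  \<open>\<bar>s\<bar>\<close>. Hence \<open>F\<close> changes sign between
  \<open>r = - e * \<bar>s\<bar>\<close> and \<open>r = e * \<bar>s\<bar>\<close>.\<close>

lemma level_set_near_tangent_line:
  fixes F :: "'a::real_inner \<Rightarrow> real"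
  assumes U: "open U" "q \<in> U" and cont: "continuous_on U F"
    and F: "(F has_derivative (\<lambda>h. n \<bullet> h)) (at q)" "F q = 0"
    and "n \<noteq> 0" "n \<bullet> v = 0" "e > 0"
  shows "\<forall>\<^sub>F s in at 0. \<exists>r. \<bar>r\<bar> \<le> e * \<bar>s\<bar> \<and> q + s *\<^sub>R v + r *\<^sub>R n \<in> U \<and> F (q + s *\<^sub>R v + r *\<^sub>R n) = 0"
proof -
  define K where "K = norm v + e * norm n"
  have K: "K > 0" using \<open>n \<noteq> 0\<close> \<open>e > 0\<close> by (simp add: K_def add_nonneg_pos)
  \<comment> \<open>This makes the error bound \<open>\<eta> * (\<bar>s\<bar> * K)\<close> half the
    size of the linear part at the two end points.\<close>
  define \<eta> where "\<eta> = e * (n \<bullet> n) / (2 * K)"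
  have "\<eta> > 0" using K \<open>n \<noteq> 0\<close> \<open>e > 0\<close> by (simp add: \<eta>_def)
  obtain d1 where d1: "d1 > 0" "ball q d1 \<subseteq> U"
    using U openE by blast
  obtain d2 where d2: "d2 > 0"
    "\<And>y. norm (y - q) < d2 \<Longrightarrow> \<bar>F y - n \<bullet> (y - q)\<bar> \<le> \<eta> * norm (y - q)"
    using F(1)[unfolded has_derivative_at_alt] \<open>\<eta> > 0\<close> F(2) by fastforce
  define d where "d = min d1 d2"
  have "\<exists>r. \<bar>r\<bar> \<le> e * \<bar>s\<bar> \<and> q + s *\<^sub>R v + r *\<^sub>R n \<in> U \<and> F (q + s *\<^sub>R v + r *\<^sub>R n) = 0"
    if s: "s \<noteq> 0" "\<bar>s\<bar> < d / K" for s
  proof -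
    have sK: "\<bar>s\<bar> * K < d" using s K by (simp add: field_simps)
    have bd: "norm (s *\<^sub>R v + r *\<^sub>R n) \<le> \<bar>s\<bar> * K" if "\<bar>r\<bar> \<le> e * \<bar>s\<bar>" for r
    proof -
      have "norm (s *\<^sub>R v + r *\<^sub>R n) \<le> \<bar>s\<bar> * norm v + \<bar>r\<bar> * norm n"
        using norm_triangle_ineq[of "s *\<^sub>R v" "r *\<^sub>R n"] by simp
      also have "\<dots> \<le> \<bar>s\<bar> * norm v + (e * \<bar>s\<bar>) * norm n"
        using that by (intro add_left_mono mult_right_mono) auto
      finally show ?thesis by (simp add: K_def algebra_simps)
    qed
    have inU: "q + s *\<^sub>R v + r *\<^sub>R n \<in> U" if "\<bar>r\<bar> \<le> e * \<bar>s\<bar>" for r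
    proof -
      have "dist q (q + s *\<^sub>R v + r *\<^sub>R n) = norm (s *\<^sub>R v + r *\<^sub>R n)"
        by (metis add.assoc add_diff_cancel_left' dist_commute dist_norm)
      then show ?thesis using bd[OF that] sK d1(2) by (auto simp: d_def subset_iff)
    qed
    have approx: "\<bar>F (q + s *\<^sub>R v + r *\<^sub>R n) - r * (n \<bullet> n)\<bar> \<le> e * \<bar>s\<bar> * (n \<bullet> n) / 2"
      if "\<bar>r\<bar> \<le> e * \<bar>s\<bar>" for r
    proof -
      have "\<bar>F (q + s *\<^sub>R v + r *\<^sub>R n) - r * (n \<bullet> n)\<bar> \<le> \<eta> * norm (s *\<^sub>R v + r *\<^sub>R n)"
        using d2(2)[of "q + s *\<^sub>R v + r *\<^sub>R n"] bd[OF that] sK \<open>n \<bullet> v = 0\<close>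
        by (simp add: d_def inner_add_right add.assoc)
      also have "\<dots> \<le> \<eta> * (\<bar>s\<bar> * K)"
        using bd[OF that] \<open>\<eta> > 0\<close> by (intro mult_left_mono) auto
      also have "\<dots> = e * \<bar>s\<bar> * (n \<bullet> n) / 2" using K by (simp add: \<eta>_def)
      finally show ?thesis .
    qed
    have pos: "e * \<bar>s\<bar> * (n \<bullet> n) > 0" "e * \<bar>s\<bar> > 0"
      using s \<open>e > 0\<close> \<open>n \<noteq> 0\<close> by auto
    have "\<exists>r. - (e * \<bar>s\<bar>) \<le> r \<and> r \<le> e * \<bar>s\<bar> \<and> F (q + s *\<^sub>R v + r *\<^sub>R n) = 0"
    proof (rule IVT')
      show "F (q + s *\<^sub>R v + (- (e * \<bar>s\<bar>)) *\<^sub>R n) \<le> 0"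
        using approx[of "- (e * \<bar>s\<bar>)"] pos unfolding mult_minus_left by linarith
      show "0 \<le> F (q + s *\<^sub>R v + (e * \<bar>s\<bar>) *\<^sub>R n)"
        using approx[of "e * \<bar>s\<bar>"] pos by linarith
      show "continuous_on {- (e * \<bar>s\<bar>)..e * \<bar>s\<bar>} (\<lambda>r. F (q + s *\<^sub>R v + r *\<^sub>R n))"
        by (rule continuous_on_compose2[OF cont], intro continuous_intros) (auto intro!: inU)
    qed (use pos in simp)
    then show ?thesis using inU by (metis abs_le_iff minus_le_iff)
  qed
  moreover have "d / K > 0" using d1 d2 K by (simp add: d_def)
  ultimately show ?thesis
    unfolding eventually_at by (intro exI[of _ "d / K"]) auto
qed

text \<open>One inclusion is the chain rule for \<open>F\<close> along a curve on which it vanishes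
  near 0. For the other, each point \<open>q + s *\<^sub>R v\<close> is moved along \<open>n\<close>
  into \<open>S\<close> by an amount that is negligible against
  \<open>\<bar>s\<bar>\<close>.\<close>

lemma tangent_space_level_set:
  assumes U: "open U" "q \<in> U" and cont: "continuous_on U F" and S: "S \<inter> U = {x \<in> U. F x = 0}"
    and F: "(F has_derivative (\<lambda>h. n \<bullet> h)) (at q)" and "F q = 0" "n \<noteq> 0"
  shows "tangent_space S q = {v. n \<bullet> v = 0}"
proof (intro set_eqI iffI)
  fix v assume "v \<in> tangent_space S q"
  then obtain \<gamma> where \<gamma>: "\<gamma> 0 = q" "\<forall>\<^sub>F s in at 0. \<gamma> s \<in> S"
    "(\<gamma> has_vector_derivative v) (at (0::real))"
    by (auto simp: tangent_space_def)
  have "\<forall>\<^sub>F s in at 0. \<gamma> s \<in> U"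
    using has_vector_derivative_continuous[OF \<gamma>(3)] U \<gamma>(1)
    unfolding continuous_at by (auto intro: topological_tendstoD)
  with \<gamma>(2) have "\<forall>\<^sub>F s in at 0. F (\<gamma> s) = 0"
    by eventually_elim (use S in blast)
  moreover have "((\<lambda>s. F (\<gamma> s)) has_vector_derivative n \<bullet> v) (at 0)"
    using vector_derivative_diff_chain_within[OF \<gamma>(3), of F "\<lambda>h. n \<bullet> h"] F \<gamma>(1)
    by (auto simp: o_def intro: has_derivative_at_withinI)
  ultimately have "((\<lambda>s. 0) has_vector_derivative n \<bullet> v) (at (0::real))"
    unfolding has_vector_derivative_def
    using has_derivative_transform_eventually[of "\<lambda>s. F (\<gamma> s)" _ 0 UNIV "\<lambda>s. 0"]
    by (simp add: \<gamma>(1) \<open>F q = 0\<close>)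
  then show "v \<in> {v. n \<bullet> v = 0}"
    using vector_derivative_unique_at has_vector_derivative_const by blast
next
  fix v assume v: "v \<in> {v. n \<bullet> v = 0}"
  \<comment> \<open>Nearly minimal \<open>\<bar>r s\<bar>\<close>: one choice of \<open>r s\<close> that beats \<open>e * \<bar>s\<bar>\<close> for every \<open>e > 0\<close> at once.\<close>
  define R where "R s = {\<bar>r\<bar> |r. q + s *\<^sub>R v + r *\<^sub>R n \<in> S}" for s
  \<comment> \<open>The infimum need not be attained, so a slack is allowed:
    \<open>s\<^sup>2\<close> is positive for \<open>s \<noteq> 0\<close> and still negligible
    against \<open>\<bar>s\<bar>\<close>.\<close>
  define P where "P s r \<longleftrightarrow> q + s *\<^sub>R v + r *\<^sub>R n \<in> S \<and> \<bar>r\<bar> < Inf (R s) + s\<^sup>2" for s r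
  define r where "r s = (SOME r. P s r)" for s
  have bdd: "bdd_below (R s)" for s by (auto simp: R_def bdd_below_def intro!: exI[of _ 0])
  have ev: "\<forall>\<^sub>F s in at 0. q + s *\<^sub>R v + r s *\<^sub>R n \<in> S \<and> \<bar>r s\<bar> \<le> e * \<bar>s\<bar> + s\<^sup>2" if "e > 0" for e
  proof -
    have "\<forall>\<^sub>F s in at 0. \<exists>r. \<bar>r\<bar> \<le> e * \<bar>s\<bar> \<and> q + s *\<^sub>R v + r *\<^sub>R n \<in> U \<and> F (q + s *\<^sub>R v + r *\<^sub>R n) = 0"
      using level_set_near_tangent_line[OF U cont F \<open>F q = 0\<close> \<open>n \<noteq> 0\<close> _ that] v by simp
    moreover have "\<forall>\<^sub>F s::real in at 0. s \<noteq> 0" by (simp add: eventually_at_filter)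
    ultimately show ?thesis
    proof eventually_elim
      case (elim s)
      then obtain r0 where r0: "\<bar>r0\<bar> \<le> e * \<bar>s\<bar>" "q + s *\<^sub>R v + r0 *\<^sub>R n \<in> S"
        using S by auto
      then have "\<bar>r0\<bar> \<in> R s" by (auto simp: R_def)
      then have Inf: "Inf (R s) \<le> \<bar>r0\<bar>" using bdd by (rule cInf_lower)
      have "\<exists>x\<in>R s. x < Inf (R s) + s\<^sup>2"
        using \<open>\<bar>r0\<bar> \<in> R s\<close> elim(2) by (intro cInf_lessD) auto
      then have "\<exists>r. P s r" by (auto simp: R_def P_def)
      then have "P s (r s)" unfolding r_def by (rule someI_ex)
      then show ?case using Inf r0(1) by (auto simp: P_def)
    qed
  qed
  \<comment> \<open>At 0 the slack vanishes and \<open>P 0\<close> has no witness, so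
    \<open>r 0\<close> is arbitrary and the value \<open>q\<close> is set separately.\<close>
  define \<gamma> where "\<gamma> s = (if s = 0 then q else q + s *\<^sub>R v + r s *\<^sub>R n)" for s
  have "\<forall>\<^sub>F s in at 0. \<gamma> s \<in> S"
  proof -
    have "\<forall>\<^sub>F s::real in at 0. s \<noteq> 0" by (simp add: eventually_at_filter)
    then show ?thesis using ev[OF zero_less_one] by eventually_elim (simp add: \<gamma>_def)
  qed
  moreover have "(\<gamma> has_vector_derivative v) (at 0)"
    unfolding has_vector_derivative_def has_derivative_within_alt2
  proof (intro conjI allI impI)
    fix e :: real assume "e > 0"
    \<comment> \<open>Both parts of the bound on \<open>\<bar>r s\<bar>\<close>, namely
      \<open>e' * \<bar>s\<bar>\<close> and \<open>s\<^sup>2\<close>, then contribute at most half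
      of \<open>e * \<bar>s\<bar>\<close>.\<close>
    define e' where "e' = e / (2 * norm n)"
    have "e' > 0" using \<open>e > 0\<close> \<open>n \<noteq> 0\<close> by (simp add: e'_def)
    have "\<forall>\<^sub>F s in at 0. \<bar>s\<bar> < e'"
      using \<open>e' > 0\<close> by (auto simp: eventually_at)
    moreover have "\<forall>\<^sub>F s::real in at 0. s \<noteq> 0" by (simp add: eventually_at_filter)
    ultimately show "\<forall>\<^sub>F s in at 0. norm (\<gamma> s - \<gamma> 0 - (s - 0) *\<^sub>R v) \<le> e * norm (s - 0)"
      using ev[OF \<open>e' > 0\<close>]
    proof eventually_elim
      case (elim s)
      have "\<bar>r s\<bar> \<le> e' * \<bar>s\<bar> + \<bar>s\<bar> * \<bar>s\<bar>" using elim(3) by (simp add: power2_eq_square)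
      also have "\<dots> \<le> e' * \<bar>s\<bar> + e' * \<bar>s\<bar>"
        using elim(1) by (intro add_left_mono mult_right_mono) auto
      finally have "\<bar>r s\<bar> * norm n \<le> (e' * \<bar>s\<bar> + e' * \<bar>s\<bar>) * norm n"
        by (intro mult_right_mono) auto
      also have "\<dots> = e * \<bar>s\<bar>" using \<open>n \<noteq> 0\<close> by (simp add: e'_def field_simps)
      finally show ?case using elim(2) by (simp add: \<gamma>_def)
    qed
  qed (rule bounded_linear_scaleR_left)
  ultimately show "v \<in> tangent_space S q"
    unfolding tangent_space_def by (auto simp: \<gamma>_def intro!: exI[of _ \<gamma>])
qed

text \<open>Along a curve in \<open>S\<close> with velocity \<open>v\<close>, both
  \<open>L v\<close> and \<open>L' v\<close> are the velocity of the image curve. This makes the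
  choice of \<open>L\<close> in \<open>has_mean_curvature_vector\<close> harmless.\<close>

lemma has_derivative_within_unique_on_tangent_space:
  assumes f: "(f has_derivative L) (at p within S)" "(f has_derivative L') (at p within S)"
    and "p \<in> S" "v \<in> tangent_space S p"
  shows "L v = L' v"
proof -
  obtain \<gamma> where \<gamma>: "\<gamma> 0 = p" "\<forall>\<^sub>F s in at 0. \<gamma> s \<in> S"
    "(\<gamma> has_vector_derivative v) (at (0::real))"
    using assms(4) by (auto simp: tangent_space_def)
  \<comment> \<open>Together with \<open>p \<in> S\<close>, which covers \<open>s = 0\<close>, the
    set \<open>T\<close> is a neighborhood of 0, so restricting the parameter to it loses
    nothing.\<close>
  define T where "T = {s. \<gamma> s \<in> S}"
  have T: "at 0 within T = at 0"
  proof -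
    obtain d where d: "d > 0" "\<And>s. s \<noteq> 0 \<Longrightarrow> dist s 0 < d \<Longrightarrow> \<gamma> s \<in> S"
      using \<gamma>(2) by (auto simp: eventually_at)
    have "\<gamma> s \<in> S" if "dist s 0 < d" for s
      using d(2)[OF _ that] \<open>p \<in> S\<close> \<gamma>(1) by (cases "s = 0") auto
    then have "ball 0 d \<subseteq> T"
      by (auto simp: T_def)
    then have "0 \<in> interior T" using d(1) by (meson centre_in_ball interior_maximal open_ball subsetD)
    then show ?thesis by (rule at_within_interior)
  qed
  have D: "((f \<circ> \<gamma>) has_vector_derivative M v) (at 0)" if "(f has_derivative M) (at p within S)" for M
  proof -
    have "((f \<circ> \<gamma>) has_vector_derivative M v) (at 0 within T)"
    proof (rule vector_derivative_diff_chain_within)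
      show "(\<gamma> has_vector_derivative v) (at 0 within T)"
        using \<gamma>(3) by (simp add: T)
      show "(f has_derivative M) (at (\<gamma> 0) within \<gamma> ` T)"
        unfolding \<gamma>(1) by (rule has_derivative_subset[OF that]) (auto simp: T_def)
    qed
    then show ?thesis by (simp add: T)
  qed
  show ?thesis using vector_derivative_unique_at D f by blast
qed

text \<open>The part of \<open>u\<close> orthogonal to \<open>n\<close> is orthogonal to
  \<open>u\<close> as well, hence to itself. Any unit normal is thus the normalized gradient up to
  sign.\<close>

lemma unit_normal_of_hyperplane:
  fixes n u :: "'a::real_inner"
  assumes "norm n = 1" "norm u = 1" and perp: "\<And>v. n \<bullet> v = 0 \<Longrightarrow> u \<bullet> v = 0"
  shows "u = (u \<bullet> n) *\<^sub>R n" "\<bar>u \<bullet> n\<bar> = 1"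
proof -
  have n: "n \<bullet> n = 1" using assms(1) by (simp add: norm_eq_1)
  define w where "w = u - (u \<bullet> n) *\<^sub>R n"
  have "n \<bullet> w = 0" by (simp add: w_def inner_diff_right n inner_commute)
  moreover from this have "u \<bullet> w = 0" by (rule perp)
  ultimately have "w \<bullet> w = 0" by (simp add: w_def inner_diff_left)
  then show u: "u = (u \<bullet> n) *\<^sub>R n" by (simp add: w_def)
  have "norm u = \<bar>u \<bullet> n\<bar> * norm n" using arg_cong[OF u, of norm] by simp
  then show "\<bar>u \<bullet> n\<bar> = 1" using assms by simp
qed

text \<open>Product rule for \<open>G\<close> times its inverse norm. The derivative
  \<open>k\<close> of the scalar factor stays unspecified because its term is a multiple of
  \<open>G p\<close>, which is orthogonal to tangent vectors.\<close>

lemma has_derivative_sgn: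
  fixes G :: "'a::real_normed_vector \<Rightarrow> 'b::real_inner"
  assumes G: "(G has_derivative A) (at p)" and "G p \<noteq> 0"
  obtains k where "((\<lambda>x. sgn (G x)) has_derivative (\<lambda>h. A h /\<^sub>R norm (G p) + k h *\<^sub>R G p)) (at p)"
proof -
  have "(\<lambda>x. inverse (norm (G x))) differentiable at p"
    using G \<open>G p \<noteq> 0\<close>
    by (intro differentiable_inverse differentiable_compose[OF differentiable_norm_at])
       (auto simp: differentiable_def)
  then obtain k where "((\<lambda>x. inverse (norm (G x))) has_derivative k) (at p)"
    by (auto simp: differentiable_def)
  from has_derivative_scaleR[OF this G] show thesis
    by (intro that[of k]) (simp add: sgn_div_norm)
qed

text \<open>Up to sign the unit normal is \<open>sgn (G x)\<close>, so zero mean curvature says that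
  the trace of the Hessian \<open>A\<close> over the orthogonal complement of \<open>G p\<close>
  vanishes. Adding the normal direction gives the full trace.\<close>

lemma zero_mean_curvature_level_set:
  fixes G A :: "real^'n \<Rightarrow> real^'n"
  assumes U: "open U" "p \<in> U" "p \<in> S" and S: "S \<inter> U = {x \<in> U. F x = 0}"
    and F: "\<And>x. x \<in> U \<Longrightarrow> (F has_derivative (\<lambda>h. G x \<bullet> h)) (at x)"
    and G: "(G has_derivative A) (at p)" and G0: "\<And>x. x \<in> S \<inter> U \<Longrightarrow> G x \<noteq> 0"
    and H: "has_mean_curvature_vector S p 0"
  shows "(G p \<bullet> G p) * (\<Sum>i\<in>UNIV. A (axis i 1) $ i) = A (G p) \<bullet> G p"
proof -
  interpret A: bounded_linear A using G by (rule has_derivative_bounded_linear)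
  obtain V \<nu> L B where V: "open V" "p \<in> V" and \<nu>: "unit_normal_field S V \<nu>"
    and L: "(\<nu> has_derivative L) (at p within S)"
    and B: "orthonormal_basis_of (tangent_space S p) B"
    and H0: "0 = (\<Sum>e\<in>B. - (L e \<bullet> e) *\<^sub>R \<nu> p)"
    using H unfolding has_mean_curvature_vector_def by blast
  have cont: "continuous_on U F"
    using F has_derivative_continuous continuous_at_imp_continuous_on by blast
  have tan: "tangent_space S q = {v. G q \<bullet> v = 0}" if "q \<in> S \<inter> U" for q
    using tangent_space_level_set[OF U(1) _ cont S F] G0 S that by auto
  define N where "N x = sgn (G x)" for x
  have N1: "norm (N q) = 1" if "q \<in> S \<inter> U" for q
    using G0[OF that] by (simp add: N_def norm_sgn)
  have \<nu>1: "norm (\<nu> q) = 1" if "q \<in> S \<inter> V" for q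
    using \<nu> that by (auto simp: unit_normal_field_def)
  have \<nu>N: "\<nu> q = (\<nu> q \<bullet> N q) *\<^sub>R N q" "\<bar>\<nu> q \<bullet> N q\<bar> = 1" if "q \<in> S \<inter> U \<inter> V" for q
  proof -
    have "\<nu> q \<bullet> v = 0" if "N q \<bullet> v = 0" for v
    proof -
      have "G q \<bullet> v = 0"
        using that G0[of q] \<open>q \<in> S \<inter> U \<inter> V\<close> by (auto simp: N_def sgn_div_norm)
      then show ?thesis
        using \<nu> tan[of q] \<open>q \<in> S \<inter> U \<inter> V\<close> by (auto simp: unit_normal_field_def)
    qed
    then show "\<nu> q = (\<nu> q \<bullet> N q) *\<^sub>R N q" "\<bar>\<nu> q \<bullet> N q\<bar> = 1"
      using unit_normal_of_hyperplane[of "N q" "\<nu> q"] N1[of q] \<nu>1[of q] that by auto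
  qed
  have p: "p \<in> S \<inter> U \<inter> V" using U V by auto
  obtain k where N': "(N has_derivative (\<lambda>h. A h /\<^sub>R norm (G p) + k h *\<^sub>R G p)) (at p)"
    using has_derivative_sgn[OF G G0] p unfolding N_def by auto
  define \<sigma> where "\<sigma> = \<nu> p \<bullet> N p"
  have \<sigma>: "\<bar>\<sigma>\<bar> = 1" using \<nu>N(2)[OF p] by (simp add: \<sigma>_def)
  \<comment> \<open>A function with values 1 and -1 that tends to \<open>\<sigma>\<close> equals
    \<open>\<sigma>\<close> near \<open>p\<close>, so the sign relating \<open>\<nu>\<close> to
    \<open>N\<close> is locally constant.\<close>
  have "((\<lambda>q. \<nu> q \<bullet> N q) \<longlongrightarrow> \<sigma>) (at p within S)"
  proof -
    have "(\<nu> \<longlongrightarrow> \<nu> p) (at p within S)"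
      using has_derivative_continuous[OF L] by (simp add: continuous_within)
    moreover have "(N \<longlongrightarrow> N p) (at p within S)"
      using has_derivative_continuous[OF has_derivative_at_withinI[OF N']]
      by (simp add: continuous_within)
    ultimately show ?thesis unfolding \<sigma>_def by (rule tendsto_inner)
  qed
  then have "\<forall>\<^sub>F q in at p within S. dist (\<nu> q \<bullet> N q) \<sigma> < 1"
    by (rule tendstoD) simp
  moreover have "\<forall>\<^sub>F q in at p within S. q \<in> S \<inter> U \<inter> V"
    unfolding eventually_at_topological using U V by (intro exI[of _ "U \<inter> V"]) auto
  ultimately have "\<forall>\<^sub>F q in at p within S. \<sigma> *\<^sub>R N q = \<nu> q"
  proof eventually_elim
    case (elim q)
    have "\<nu> q \<bullet> N q = \<sigma>" using elim(1) \<sigma> \<nu>N(2)[OF elim(2)] by (auto simp: dist_real_def)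
    then show ?case using \<nu>N(1)[OF elim(2)] by simp
  qed
  moreover have "((\<lambda>q. \<sigma> *\<^sub>R N q) has_derivative
      (\<lambda>h. \<sigma> *\<^sub>R (A h /\<^sub>R norm (G p) + k h *\<^sub>R G p))) (at p within S)"
    by (intro has_derivative_scaleR_right has_derivative_at_withinI[OF N'])
  ultimately have L': "(\<nu> has_derivative (\<lambda>h. \<sigma> *\<^sub>R (A h /\<^sub>R norm (G p) + k h *\<^sub>R G p))) (at p within S)"
    using has_derivative_transform_eventually[of "\<lambda>q. \<sigma> *\<^sub>R N q" _ p S \<nu>] \<nu>N(1)[OF p, folded \<sigma>_def]
      \<open>p \<in> S\<close> by simp
  have BT: "B \<subseteq> {v. G p \<bullet> v = 0}" and B': "pairwise orthogonal B" "\<And>e. e \<in> B \<Longrightarrow> norm e = 1"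
    "span B = {v. G p \<bullet> v = 0}"
    using B tan[of p] p by (auto simp: orthonormal_basis_of_def)
  \<comment> \<open>\<open>L\<close> agrees on tangent vectors with the derivative of
    \<open>\<sigma> *\<^sub>R N\<close>, whose component along \<open>G p\<close> is orthogonal to
    \<open>e\<close>.\<close>
  have "L e \<bullet> e = \<sigma> / norm (G p) * (A e \<bullet> e)" if "e \<in> B" for e
  proof -
    have e: "G p \<bullet> e = 0" using BT that by auto
    then have "L e = \<sigma> *\<^sub>R (A e /\<^sub>R norm (G p) + k e *\<^sub>R G p)"
      using has_derivative_within_unique_on_tangent_space[OF L L'] tan[of p] p by auto
    then show ?thesis using e by (simp add: inner_add_left divide_inverse)
  qed
  then have "(\<Sum>e\<in>B. L e \<bullet> e) = \<sigma> / norm (G p) * (\<Sum>e\<in>B. A e \<bullet> e)"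
    by (simp add: sum_distrib_left)
  moreover have "(\<Sum>e\<in>B. L e \<bullet> e) = 0"
    using H0 \<nu>1[of p] p by (auto simp: sum_negf simp flip: scaleR_left.sum)
  ultimately have trB: "(\<Sum>e\<in>B. A e \<bullet> e) = 0" using \<sigma> G0[of p] p by auto
  have "N p \<bullet> v = 0 \<longleftrightarrow> G p \<bullet> v = 0" for v using G0[of p] p by (auto simp: N_def sgn_div_norm)
  then have NB: "N p \<bullet> e = 0" if "e \<in> B" for e using BT that by auto
  have Np: "N p \<bullet> N p = 1" using N1[of p] p by (simp add: norm_eq_1)
  have "N p \<notin> B" using NB Np by auto
  \<comment> \<open>The unit normal completes \<open>B\<close> to an orthonormal basis of the whole
    space; its summand is all that remains of the trace.\<close>
  have "span (insert (N p) B) = UNIV"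
  proof -
    have "x \<in> span (insert (N p) B)" for x
    proof -
      have "N p \<bullet> (x - (x \<bullet> N p) *\<^sub>R N p) = 0"
        by (simp add: inner_diff_right Np inner_commute)
      then have "x - (x \<bullet> N p) *\<^sub>R N p \<in> span B"
        using B'(3) \<open>\<And>v. (N p \<bullet> v = 0) = (G p \<bullet> v = 0)\<close> by auto
      then show ?thesis using span_breakdown_eq by blast
    qed
    then show ?thesis by auto
  qed
  moreover have "pairwise orthogonal (insert (N p) B)"
    using B'(1) NB by (auto simp: pairwise_insert orthogonal_def inner_commute)
  ultimately have "(\<Sum>i\<in>UNIV. A (axis i 1) $ i) = (\<Sum>b\<in>insert (N p) B. A b \<bullet> b)"
    by (intro sum_inner_orthonormal_basis[symmetric] A.linear) (use B'(2) N1[of p] p in auto)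
  also have "\<dots> = A (N p) \<bullet> N p"
    using trB \<open>N p \<notin> B\<close> pairwise_orthogonal_imp_finite[OF B'(1)] by simp
  also have "\<dots> = A (G p) \<bullet> G p / (G p \<bullet> G p)"
    by (simp add: N_def sgn_div_norm A.scaleR dot_square_norm power2_eq_square divide_inverse mult_ac)
  finally show ?thesis using G0[of p] p by simp
qed

subsection \<open>Weighted dilations\<close>

lemma C2_on_imp_has_derivative_grad:
  assumes "open U" "C2_on F U" "x \<in> U"
  shows "(F has_derivative (\<lambda>h. grad F x \<bullet> h)) (at x)"
proof -
  have F: "(F has_derivative frechet_derivative F (at x)) (at x)"
    using assms unfolding C2_on_def differentiable_on_def
    by (metis at_within_open frechet_derivative_works)
  interpret L: bounded_linear "frechet_derivative F (at x)"
    using F by (rule has_derivative_bounded_linear)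
  have "frechet_derivative F (at x) h = grad F x \<bullet> h" for h
  proof -
    have "frechet_derivative F (at x) h = frechet_derivative F (at x) (\<Sum>i\<in>UNIV. h $ i *\<^sub>R axis i 1)"
      using basis_expansion[of h] by (simp add: scalar_mult_eq_scaleR)
    then show ?thesis
      by (simp add: L.sum L.scaleR grad_def partial_def inner_vec_def mult.commute)
  qed
  then have "frechet_derivative F (at x) = (\<lambda>h. grad F x \<bullet> h)" by (rule ext)
  then show ?thesis using F by simp
qed

lemma C2_on_imp_has_derivative_partial:
  assumes "open U" "C2_on F U" "x \<in> U"
  shows "(partial i F has_derivative frechet_derivative (partial i F) (at x)) (at x)"
  using assms unfolding C2_on_def differentiable_on_def
  by (metis at_within_open frechet_derivative_works)

lemma C2_on_imp_grad_has_derivative: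
  assumes "open U" "C2_on F U" "x \<in> U"
  shows "(grad F has_derivative (\<lambda>h. \<chi> i. frechet_derivative (partial i F) (at x) h)) (at x)"
  unfolding has_derivative_componentwise_within[of "grad F"]
  using C2_on_imp_has_derivative_partial[OF assms]
  by (auto simp: Basis_vec_def inner_axis grad_def)

lemma partial_commute:
  assumes "open U" "C2_on F U" "x \<in> U"
  shows "partial j (partial i F) x = partial i (partial j F) x"
proof -
  have D: "((\<lambda>y. grad F y \<bullet> axis i 1) has_derivative frechet_derivative (partial i F) (at x)) (at x)"
    for i
    using C2_on_imp_has_derivative_partial[OF assms, of i]
    by (simp add: grad_def inner_axis)
  show ?thesis
    unfolding partial_def[of i "partial j F"] partial_def[of j "partial i F"]
    by (rule symmetric_second_derivative[where f = F and f' = "\<lambda>y h. grad F y \<bullet> h", OF assms(1,3) _ D D])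
       (rule C2_on_imp_has_derivative_grad[OF assms(1,2)])
qed

section \<open>Summing over and counting pairs of indices\<close>

lemma sum_sum_eq_sum_pairs_less:
  fixes f :: "'a::{finite,linorder} \<Rightarrow> 'a \<Rightarrow> 'b::comm_monoid_add"
  assumes "\<And>i. f i i = 0"
  shows "(\<Sum>i\<in>UNIV. \<Sum>j\<in>UNIV. f i j) = (\<Sum>(i, j)\<in>{(i, j). i < j}. f i j + f j i)"
proof -
  let ?A = "{(i, j). i < j} :: ('a \<times> 'a) set"
  let ?B = "{(i, j). j < i} :: ('a \<times> 'a) set"
  have "(\<Sum>i\<in>UNIV. \<Sum>j\<in>UNIV. f i j) = (\<Sum>(i, j)\<in>UNIV. f i j)"
    by (simp add: sum.cartesian_product)
  also have "\<dots> = (\<Sum>(i, j)\<in>?A \<union> ?B. f i j)"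
    using assms by (intro sum.mono_neutral_right) (auto simp: not_less order_le_less)
  also have "\<dots> = (\<Sum>(i, j)\<in>?A. f i j) + (\<Sum>(i, j)\<in>?B. f i j)"
    by (intro sum.union_disjoint) auto
  also have "(\<Sum>(i, j)\<in>?B. f i j) = (\<Sum>(i, j)\<in>?A. f j i)"
    by (rule sum.reindex_bij_witness[of _ prod.swap prod.swap]) auto
  finally show ?thesis by (simp add: sum.distrib case_prod_unfold)
qed

text \<open>A pair with \<open>i < j\<close> is determined by its two-element set. The bound ensures
  that the exponential sum has no more terms than given zeros.\<close>

lemma card_pairs_less_le:
  "card {(i, j). i < (j :: 'a::{finite,linorder})} \<le> CARD('a) choose 2"
proof -
  have "inj_on (\<lambda>(i, j). {i, j}) {(i, j). i < (j :: 'a)}"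
    by (auto simp: inj_on_def doubleton_eq_iff)
  then have "card {(i, j). i < (j :: 'a)} \<le> card {B :: 'a set. B \<subseteq> UNIV \<and> card B = 2}"
    by (rule card_inj_on_le) auto
  then show ?thesis using n_subsets[of "UNIV :: 'a set" 2] by simp
qed

text \<open>The inverse is again a weighted dilation, so linearity and self-adjointness apply to it
  too.\<close>

lemma weighted_dilation_minus:
  assumes "s > 0"
  shows "weighted_dilation (\<lambda>i. - g i) s (weighted_dilation g s x) = x"
    "weighted_dilation g s (weighted_dilation (\<lambda>i. - g i) s x) = x"
  using assms by (simp_all add: weighted_dilation_def vec_eq_iff powr_minus)

lemma bounded_linear_weighted_dilation: "bounded_linear (weighted_dilation g s)"
  by (intro linear_conv_bounded_linear[THEN iffD1] linearI)
     (simp_all add: weighted_dilation_def vec_eq_iff algebra_simps)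

lemma inner_weighted_dilation: "weighted_dilation g s x \<bullet> y = x \<bullet> weighted_dilation g s y"
  by (simp add: weighted_dilation_def inner_vec_def mult_ac)

text \<open>With \<open>E\<close> the inverse dilation, \<open>F \<circ> E\<close> defines the
  dilated hypersurface; the identity of \<open>zero_mean_curvature_level_set\<close> for it is
  pulled back to \<open>p\<close> and regrouped by pairs.\<close>

lemma sum_C_form_zero:
  fixes S :: "(real^'n::{finite,linorder}) set"
  assumes reg: "regular_defining_function S U F" and p: "p \<in> S \<inter> U" and "s > 0"
    and min: "minimal (weighted_dilation g s ` S)"
  shows "(\<Sum>(i, j)\<in>{(i, j). i < j}. C_form i j F p * exp (- 2 * (g i + g j) * ln s)) = 0"
proof -
  have U: "open U" and F: "C2_on F U" and S: "S \<inter> U = {x \<in> U. F x = 0}"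
    and G0: "\<And>x. x \<in> S \<inter> U \<Longrightarrow> grad F x \<noteq> 0"
    using reg by (auto simp: regular_defining_function_def)
  define D where "D = weighted_dilation g s"
  define E where "E = weighted_dilation (\<lambda>i. - g i) s"
  have ED [simp]: "E (D x) = x" "D (E x) = x" for x
    using weighted_dilation_minus[OF \<open>s > 0\<close>] by (auto simp: D_def E_def)
  interpret E: bounded_linear E unfolding E_def by (rule bounded_linear_weighted_dilation)
  have Eadj: "E x \<bullet> y = x \<bullet> E y" for x y unfolding E_def by (rule inner_weighted_dilation)
  have E': "(E has_derivative E) (at x)" for x by (rule E.has_derivative) simp
  define a where "a i j = partial j (partial i F) p" for i j
  define A where "A h = (\<chi> i. frechet_derivative (partial i F) (at p) h)" for h
  have A: "(grad F has_derivative A) (at p)"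
    unfolding A_def using C2_on_imp_grad_has_derivative[OF U F] p by auto
  interpret A: bounded_linear A using A by (rule has_derivative_bounded_linear)
  have A_nth: "A h $ i = (\<Sum>j\<in>UNIV. h $ j * a i j)" for h i
  proof -
    have "A h = A (\<Sum>j\<in>UNIV. h $ j *\<^sub>R axis j 1)"
      using basis_expansion[of h] by (simp add: scalar_mult_eq_scaleR)
    then show ?thesis by (simp add: A.sum A.scaleR) (simp add: A_def a_def partial_def)
  qed
  \<comment> \<open>As \<open>E\<close> is self-adjoint, this is the gradient of
    \<open>F \<circ> E\<close>, and the Hessian at \<open>D p\<close> is
    \<open>E \<circ> A \<circ> E\<close>.\<close>
  define G' where "G' y = E (grad F (E y))" for y
  have D_image: "D ` X = E -` X" for X
    by (auto simp: image_iff) (metis ED(2))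
  have "open (D ` U)"
    unfolding D_image using U E.continuous_on[OF continuous_on_id] by (simp add: open_vimage)
  moreover have "D p \<in> D ` U" "D p \<in> D ` S" using p by auto
  moreover have "D ` S \<inter> D ` U = {y \<in> D ` U. F (E y) = 0}"
    using S unfolding D_image by auto
  moreover have "((\<lambda>y. F (E y)) has_derivative (\<lambda>h. G' y \<bullet> h)) (at y)" if "y \<in> D ` U" for y
  proof -
    have "E y \<in> U" using that by (simp add: D_image)
    from has_derivative_compose[OF E' C2_on_imp_has_derivative_grad[OF U F this]]
    show ?thesis by (simp add: G'_def Eadj)
  qed
  moreover have "(G' has_derivative (\<lambda>h. E (A (E h)))) (at (D p))"
    unfolding G'_def
    by (intro E.has_derivative has_derivative_compose[OF E']) (simp add: A)
  moreover have "G' y \<noteq> 0" if "y \<in> D ` S \<inter> D ` U" for y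
  proof -
    have "grad F (E y) \<noteq> 0" using G0[of "E y"] that by (simp add: D_image)
    then show ?thesis unfolding G'_def by (metis ED(2) E.zero)
  qed
  moreover have "has_mean_curvature_vector (D ` S) (D p) 0"
    using min p by (auto simp: minimal_def D_def)
  ultimately have eq: "(G' (D p) \<bullet> G' (D p)) * (\<Sum>i\<in>UNIV. E (A (E (axis i 1))) $ i)
      = E (A (E (G' (D p)))) \<bullet> G' (D p)"
    by (rule zero_mean_curvature_level_set)
  \<comment> \<open>In every term of the identity each of the indices \<open>i\<close> and
    \<open>j\<close> occurs twice, each time with a factor from \<open>E\<close>; hence the
    square.\<close>
  define w where "w i = (s powr - g i)\<^sup>2" for i
  define G where "G = grad F p"
  \<comment> \<open>The summands of the trace identity: \<open>m i i = 0\<close>, and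
    \<open>m i j + m j i\<close> is \<open>C_form i j F p\<close>.\<close>
  define m where "m i j = G $ j * G $ j * a i i - G $ i * G $ j * a i j" for i j
  have E_nth: "E h $ i = s powr - g i * h $ i" for h i by (simp add: E_def weighted_dilation_def)
  have "G' (D p) \<bullet> G' (D p) = (\<Sum>j\<in>UNIV. w j * (G $ j * G $ j))"
    by (simp add: G'_def G_def inner_vec_def E_nth w_def power2_eq_square mult_ac)
  moreover have "E (A (E (axis i 1))) $ i = w i * a i i" for i
    by (simp add: E_nth A_nth axis_def if_distrib[of "\<lambda>x. _ * x"] if_distrib[of "\<lambda>x. x * _"]
        w_def power2_eq_square cong: if_cong)
  moreover have "E (A (E (G' (D p)))) \<bullet> G' (D p) =
      (\<Sum>i\<in>UNIV. \<Sum>j\<in>UNIV. w i * w j * (G $ i * G $ j * a i j))"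
    by (simp add: G'_def G_def inner_vec_def E_nth A_nth w_def power2_eq_square
        sum_distrib_left sum_distrib_right mult_ac)
  ultimately have "(\<Sum>i\<in>UNIV. \<Sum>j\<in>UNIV. w j * (G $ j * G $ j) * (w i * a i i)) =
      (\<Sum>i\<in>UNIV. \<Sum>j\<in>UNIV. w i * w j * (G $ i * G $ j * a i j))"
    using eq by (simp add: sum_product) (subst sum.swap, simp)
  then have "(\<Sum>i\<in>UNIV. \<Sum>j\<in>UNIV. w i * w j * m i j) = 0"
    by (simp add: m_def right_diff_distrib sum_subtractf mult_ac)
  then have "(\<Sum>(i, j)\<in>{(i, j). i < j}. w i * w j * m i j + w j * w i * m j i) = 0"
    by (subst (asm) sum_sum_eq_sum_pairs_less) (simp_all add: m_def)
  moreover have "w i * w j * m i j + w j * w i * m j i =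
      C_form i j F p * exp (- 2 * (g i + g j) * ln s)" for i j
  proof -
    \<comment> \<open>\<open>m i j + m j i\<close> contains both mixed derivatives, while
      \<open>C_form\<close> contains one of them twice.\<close>
    have "a i j = a j i" using partial_commute[OF U F] p by (simp add: a_def)
    moreover have "G $ k = partial k F p" for k by (simp add: G_def grad_def)
    ultimately have "m i j + m j i = C_form i j F p"
      unfolding m_def C_form_def a_def by (simp add: power2_eq_square algebra_simps)
    moreover have "w i * w j = exp (- 2 * (g i + g j) * ln s)"
      using \<open>s > 0\<close> by (simp add: w_def powr_def power2_eq_square algebra_simps flip: exp_add)
    moreover have "w i * w j * m i j + w j * w i * m j i = (m i j + m j i) * (w i * w j)"
      by (simp add: algebra_simps)
    ultimately show ?thesis by simp
  qed
  ultimately show ?thesis by simp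
qed

theorem lemma2p8:
  fixes S :: "(real ^ 'n::{finite,linorder}) set"
    and g :: "'n \<Rightarrow> real"
    and t :: "nat \<Rightarrow> real"
  assumes "CARD('n) \<ge> 2"
    and "C2_hypersurface S"
    and "\<And>i. g i > 0"
    and "pair_sum_nonresonant g"
    and "\<And>k. k \<in> {1..CARD('n) choose 2} \<Longrightarrow> t k > 0"
    and "inj_on t {1..CARD('n) choose 2}"
    and "\<And>k. k \<in> {1..CARD('n) choose 2} \<Longrightarrow> minimal (weighted_dilation g (t k) ` S)"
  shows "\<forall>U F. regular_defining_function S U F \<longrightarrow>
           (\<forall>i j. i < j \<longrightarrow> (\<forall>x \<in> S \<inter> U. C_form i j F x = 0))"
proof (intro allI impI ballI)
  fix U F and i j :: 'n and x
  assume F: "regular_defining_function S U F" and ij: "i < j" and x: "x \<in> S \<inter> U"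
  let ?N = "{1..CARD('n) choose 2}" and ?I = "{(i, j). i < j} :: ('n \<times> 'n) set"
  let ?l = "\<lambda>(i, j). - 2 * (g i + g j)" and ?c = "\<lambda>(i, j). C_form i j F x"
  have inj: "inj_on (\<lambda>k. ln (t k)) ?N"
    using assms(5,6) by (auto simp: inj_on_def)
  have "\<forall>k\<in>?I. ?c k = 0"
  \<comment> \<open>For fixed \<open>x\<close> the coefficients are the same for all dilations, so
    the logarithms of the \<open>t k\<close> are zeros of one and the same sum. Its exponents are
    distinct by nonresonance.\<close>
  proof (rule exp_sum_zero_imp_coeffs_zero[where Z = "(\<lambda>k. ln (t k)) ` ?N"])
    show "inj_on ?l ?I"
      using assms(4) by (auto simp: pair_sum_nonresonant_def inj_on_def)
    show "card ?I \<le> card ((\<lambda>k. ln (t k)) ` ?N)"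
      using card_pairs_less_le card_image[OF inj] by simp
    show "(\<Sum>k\<in>?I. ?c k * exp (?l k * z)) = 0" if "z \<in> (\<lambda>k. ln (t k)) ` ?N" for z
      using that sum_C_form_zero[OF F x assms(5) assms(7)] by (auto simp: case_prod_unfold)
  qed auto
  then show "C_form i j F x = 0" using ij by auto
qed

end
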